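(* $\mathrm{DISJ}\in\mathrm{HNN}$: the disjointness function $\mathrm{DISJ}:\{0,1\}^{2n}\to\{0,1\}$ has an HNN representation with $3n$ anchors.
   Context: $\mathrm{DISJ}(\mathbf{x},\mathbf{y})=\mathbf{1}[\langle\mathbf{x},\mathbf{y}\rangle=0]$ for $\mathbf{x},\mathbf{y}\in\{0,1\}^n$. Let $\Delta(\mathbf{u},\mathbf{v})=\|\mathbf{u}-\mathbf{v}\|_2^2$. An HNN representation of $f:\{0,1\}^{d}\to\{0,1\}$ is a pair of disjoint sets $P,N\subseteq\{0,1\}^{d}$ (anchors) such that $f(\mathbf{z})=1$ if some $\mathbf{p}\in P$ has $\Delta(\mathbf{z},\mathbf{p})<\Delta(\mathbf{z},\mathbf{q})$ for all $\mathbf{q}\in N$, and $f(\mathbf{z})=0$ if some $\mathbf{q}\in N$ has $\Delta(\mathbf{z},\mathbf{q})<\Delta(\mathbf{z},\mathbf{p})$ for all $\mathbf{p}\in P$; the number of anchors is $|P|+|N|$. $\mathrm{HNN}$ is the class of functions with HNN representations having polynomially many anchors. *)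

theory Defs
  imports "Jordan_Normal_Form.Matrix" "HOL-Computational_Algebra.Polynomial"
begin

definition bool_cube :: "nat \<Rightarrow> real vec set" where
  "bool_cube d = {v \<in> carrier_vec d. \<forall>i<d. v $ i \<in> {0, 1}}"

definition sq_dist :: "real vec \<Rightarrow> real vec \<Rightarrow> real" where
  "sq_dist u v = (u - v) \<bullet> (u - v)"

definition disj :: "real vec \<Rightarrow> real vec \<Rightarrow> nat" where
  "disj x y = (if x \<bullet> y = 0 then 1 else 0)"

(* The input z of length 2n is the concatenation of x and y, each of length n. *)
definition DISJ :: "nat \<Rightarrow> real vec \<Rightarrow> nat" where
  "DISJ n z = disj (vec_first z n) (vec_last z n)"

(* The two nearest-anchor conditions exclude each other. Stating both clauses as equivalences,
   together with f taking only the values 0 and 1, says that every input is decided (no ties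
   between P and N) and decided correctly; plain implications would hold vacuously for
   P = N = {}. *)
definition hnn_representation ::
    "nat \<Rightarrow> (real vec \<Rightarrow> nat) \<Rightarrow> real vec set \<Rightarrow> real vec set \<Rightarrow> bool" where
  "hnn_representation d f P N \<longleftrightarrow>
     P \<subseteq> bool_cube d \<and> N \<subseteq> bool_cube d \<and> P \<inter> N = {} \<and>
     (\<forall>z\<in>bool_cube d.
        f z \<in> {0, 1} \<and>
        (f z = 1 \<longleftrightarrow> (\<exists>p\<in>P. \<forall>q\<in>N. sq_dist z p < sq_dist z q)) \<and>
        (f z = 0 \<longleftrightarrow> (\<exists>q\<in>N. \<forall>p\<in>P. sq_dist z q < sq_dist z p)))"

(* A member is a family of Boolean functions, the n-th one given by its input dimension and the
   function on the cube of that dimension. The anchor bound is polynomial in the dimension. *)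
definition HNN :: "(nat \<Rightarrow> nat \<times> (real vec \<Rightarrow> nat)) set" where
  "HNN = {F. \<exists>p :: nat poly. \<forall>n. case F n of (d, f) \<Rightarrow>
            \<exists>P N. hnn_representation d f P N \<and> card P + card N \<le> poly p d}"

end

theory Submission
  imports Defs
begin

text \<open>Take all $2n$ unit vectors as positive anchors and the $n$ vectors $e_i + e_{n+i}$ as
  negative anchors. With $s = \|z\|_2^2$, the squared distances are
  $s + 1 - 2 z_i$ and $s + 2 - 2 (z_i + z_{n+i})$. If $x$ and $y$ intersect, the negative
  minimum $s - 2$ beats the positive minimum $s - 1$. Otherwise the negative minimum is $s$ against
  $s - 1$, or, for $z = 0$, it is $s + 2$ against $s + 1$.\<close>

lemma sq_dist_expand:
  assumes "u \<in> carrier_vec d" "v \<in> carrier_vec d"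
  shows "sq_dist u v = u \<bullet> u - 2 * (u \<bullet> v) + v \<bullet> v"
  using assms unfolding sq_dist_def
  by (simp add: minus_scalar_prod_distrib[of _ d] scalar_prod_minus_distrib[of _ d]
      comm_scalar_prod[of v d u])

text \<open>Witnesses p and q for the two nearest-anchor conditions would give strict inequalities
  in both directions between the same two distances. The conditions therefore exclude each other,
  and since \<open>f z\<close> is 0 or 1, the two implications already yield both
  equivalences.\<close>

lemma hnn_representationI:
  assumes "P \<subseteq> bool_cube d" "N \<subseteq> bool_cube d" "P \<inter> N = {}"
    and range: "\<And>z. z \<in> bool_cube d \<Longrightarrow> f z \<in> {0, 1}"
    and pos: "\<And>z. z \<in> bool_cube d \<Longrightarrow> f z = 1 \<Longrightarrow> \<exists>p\<in>P. \<forall>q\<in>N. sq_dist z p < sq_dist z q"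
    and neg: "\<And>z. z \<in> bool_cube d \<Longrightarrow> f z = 0 \<Longrightarrow> \<exists>q\<in>N. \<forall>p\<in>P. sq_dist z q < sq_dist z p"
  shows "hnn_representation d f P N"
proof -
  have "f z \<in> {0, 1} \<and>
        (f z = 1 \<longleftrightarrow> (\<exists>p\<in>P. \<forall>q\<in>N. sq_dist z p < sq_dist z q)) \<and>
        (f z = 0 \<longleftrightarrow> (\<exists>q\<in>N. \<forall>p\<in>P. sq_dist z q < sq_dist z p))" if z: "z \<in> bool_cube d" for z
  proof -
    have excl: "\<not> ((\<exists>p\<in>P. \<forall>q\<in>N. sq_dist z p < sq_dist z q) \<and>
                   (\<exists>q\<in>N. \<forall>p\<in>P. sq_dist z q < sq_dist z p))"
      by (meson less_asym)
    from range[OF z] consider "f z = 0" | "f z = 1" by auto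
    then show ?thesis
    proof cases
      case 1
      with neg[OF z] excl show ?thesis by simp
    next
      case 2
      with pos[OF z] excl show ?thesis by simp
    qed
  qed
  with assms(1-3) show ?thesis
    unfolding hnn_representation_def by blast
qed

lemma DISJ_range: "DISJ n z \<in> {0, 1}"
  by (simp add: DISJ_def disj_def)

text \<open>On the cube all products of entries are nonnegative, so nothing cancels in the inner
  product: it vanishes only if every summand does.\<close>

lemma DISJ_eq_1_iff:
  assumes z: "z \<in> bool_cube (2 * n)"
  shows "DISJ n z = 1 \<longleftrightarrow> (\<forall>i<n. z $ i = 0 \<or> z $ (n + i) = 0)"
proof -
  have dim: "dim_vec z = 2 * n" and nonneg: "\<And>i. i < 2 * n \<Longrightarrow> 0 \<le> z $ i"
    using z by (force simp: bool_cube_def)+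
  have "vec_first z n \<bullet> vec_last z n = (\<Sum>i = 0..<n. z $ i * z $ (n + i))"
    \<comment> \<open>As z has dimension 2n, its last n coordinates start at offset n.\<close>
    by (simp add: scalar_prod_def vec_first_def vec_last_def dim)
  also have "\<dots> = 0 \<longleftrightarrow> (\<forall>i\<in>{0..<n}. z $ i * z $ (n + i) = 0)"
    by (rule sum_nonneg_eq_0_iff) (auto intro!: mult_nonneg_nonneg nonneg)
  finally show ?thesis
    by (auto simp: DISJ_def disj_def)
qed

definition pos_anchors :: "nat \<Rightarrow> real vec set" where
  "pos_anchors n = unit_vec (2 * n) ` {..<2 * n}"

definition pair_vec :: "nat \<Rightarrow> nat \<Rightarrow> real vec" where
  "pair_vec n i = unit_vec (2 * n) i + unit_vec (2 * n) (n + i)"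

definition neg_anchors :: "nat \<Rightarrow> real vec set" where
  "neg_anchors n = pair_vec n ` {..<n}"

lemma pair_vec_carrier [simp]: "pair_vec n i \<in> carrier_vec (2 * n)"
  by (simp add: pair_vec_def)

lemma pair_vec_index:
  assumes "i < n" "j < 2 * n"
  shows "pair_vec n i $ j = (if j = i \<or> j = n + i then 1 else 0)"
  using assms by (auto simp: pair_vec_def unit_vec_def)

lemma scalar_prod_pair_vec:
  assumes "z \<in> carrier_vec (2 * n)" "i < n"
  shows "z \<bullet> pair_vec n i = z $ i + z $ (n + i)"
  using assms by (simp add: pair_vec_def scalar_prod_add_distrib[of _ "2 * n"])

lemma sq_dist_unit_vec:
  assumes "z \<in> carrier_vec d" "i < d"
  shows "sq_dist z (unit_vec d i) = z \<bullet> z + 1 - 2 * z $ i"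
  using assms by (simp add: sq_dist_expand[of _ d])

lemma sq_dist_pair_vec:
  assumes "z \<in> carrier_vec (2 * n)" "i < n"
  shows "sq_dist z (pair_vec n i) = z \<bullet> z + 2 - 2 * (z $ i + z $ (n + i))"
  using assms
  \<comment> \<open>The constant 2 is the squared norm of the anchor, obtained by applying
    \<open>scalar_prod_pair_vec\<close> to \<open>pair_vec n i\<close> itself.\<close>
  by (simp add: sq_dist_expand[of _ "2 * n"] scalar_prod_pair_vec pair_vec_index)

lemma inj_on_unit_vec: "inj_on (unit_vec d :: nat \<Rightarrow> real vec) {..<d}"
proof (rule inj_onI)
  fix i j assume "i \<in> {..<d}" "j \<in> {..<d}" "unit_vec d i = (unit_vec d j :: real vec)"
  then have "unit_vec d j $ i = (1 :: real)" "i < d" "j < d"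
    by (auto simp flip: \<open>unit_vec d i = _\<close>)
  then show "i = j"
    by (simp add: unit_vec_def split: if_splits)
qed

lemma inj_on_pair_vec: "inj_on (pair_vec n) {..<n}"
proof (rule inj_onI)
  fix i j assume ij: "i \<in> {..<n}" "j \<in> {..<n}" "pair_vec n i = pair_vec n j"
  then have "pair_vec n j $ i = 1"
    using pair_vec_index[of i n i] by simp
  \<comment> \<open>An entry 1 at position i means i = j or i = n + j, and i < n rules out the
    latter.\<close>
  with ij show "i = j"
    by (simp add: pair_vec_index split: if_splits)
qed

lemma card_anchors: "card (pos_anchors n) + card (neg_anchors n) = 3 * n"
  by (simp add: pos_anchors_def neg_anchors_def card_image inj_on_unit_vec inj_on_pair_vec)

lemma anchors_disjoint: "pos_anchors n \<inter> neg_anchors n = {}"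
proof -
  have "unit_vec (2 * n) i \<noteq> pair_vec n j" if "i < 2 * n" "j < n" for i j
  proof
    assume "unit_vec (2 * n) i = pair_vec n j"
    \<comment> \<open>The squared norms differ: 1 for a unit vector, 2 for a pair vector.\<close>
    then have "unit_vec (2 * n) i \<bullet> unit_vec (2 * n) i = pair_vec n j \<bullet> pair_vec n j"
      by simp
    with that show False
      by (simp add: scalar_prod_pair_vec pair_vec_index)
  qed
  then show ?thesis
    by (auto simp: pos_anchors_def neg_anchors_def)
qed

lemma hnn_representation_DISJ:
  assumes "n \<ge> 1"
  shows "hnn_representation (2 * n) (DISJ n) (pos_anchors n) (neg_anchors n)"
proof (rule hnn_representationI)
  show "pos_anchors n \<subseteq> bool_cube (2 * n)"
    by (auto simp: pos_anchors_def bool_cube_def unit_vec_def)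
  show "neg_anchors n \<subseteq> bool_cube (2 * n)"
    by (auto simp: neg_anchors_def bool_cube_def pair_vec_index)
  show "pos_anchors n \<inter> neg_anchors n = {}"
    by (rule anchors_disjoint)
  show "DISJ n z \<in> {0, 1}" for z
    by (rule DISJ_range)
next
  fix z assume z: "z \<in> bool_cube (2 * n)"
  then have carr: "z \<in> carrier_vec (2 * n)" and bits: "\<And>i. i < 2 * n \<Longrightarrow> z $ i = 0 \<or> z $ i = 1"
    by (auto simp: bool_cube_def)
  {
    assume "DISJ n z = 1"
    then have disjoint: "\<And>i. i < n \<Longrightarrow> z $ i = 0 \<or> z $ (n + i) = 0"
      using DISJ_eq_1_iff[OF z] by blast
    \<comment> \<open>The unit vector at k is strictly closer than the i-th pair vector iff 2 (z_i +
      z_{n+i}) < 2 z_k + 1, so it suffices that z_k bounds every pair sum. Any k with z_k = 1 does,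
      because disjointness keeps each pair sum at most 1.\<close>
    obtain k where k: "k < 2 * n" and above: "\<And>i. i < n \<Longrightarrow> z $ i + z $ (n + i) \<le> z $ k"
    proof (cases "\<exists>k<2 * n. z $ k = 1")
      case True
      then obtain k where "k < 2 * n" "z $ k = 1" by blast
      moreover have "z $ i + z $ (n + i) \<le> 1" if "i < n" for i
        using disjoint[OF that] bits[of i] bits[of "n + i"] that by auto
      ultimately show ?thesis using that by simp
    next
      case False
      then have "z $ i = 0" if "i < 2 * n" for i
        using bits that by blast
      \<comment> \<open>All entries vanish, so any index serves; n >= 1 ensures that index 0
        exists.\<close>
      with assms that[of 0] show ?thesis by simp
    qed
    have "sq_dist z (unit_vec (2 * n) k) < sq_dist z (pair_vec n i)" if "i < n" for i
      using above[OF that] by (simp add: sq_dist_unit_vec sq_dist_pair_vec carr k that)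
    with k show "\<exists>p\<in>pos_anchors n. \<forall>q\<in>neg_anchors n. sq_dist z p < sq_dist z q"
      by (auto simp: pos_anchors_def neg_anchors_def)
  next
    assume "DISJ n z = 0"
    then obtain i where i: "i < n" "z $ i \<noteq> 0" "z $ (n + i) \<noteq> 0"
      using DISJ_eq_1_iff[OF z] by auto
    then have ones: "z $ i = 1" "z $ (n + i) = 1"
      using bits[of i] bits[of "n + i"] by auto
    \<comment> \<open>With s the squared norm of z, the left side is s + 2 - 4 = s - 2, while the
      right side is s + 1 or s - 1.\<close>
    have "sq_dist z (pair_vec n i) < sq_dist z (unit_vec (2 * n) k)" if "k < 2 * n" for k
      using bits[OF that] ones by (auto simp: sq_dist_unit_vec sq_dist_pair_vec carr i(1) that)
    with i(1) show "\<exists>q\<in>neg_anchors n. \<forall>p\<in>pos_anchors n. sq_dist z q < sq_dist z p"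
      by (auto simp: pos_anchors_def neg_anchors_def)
  }
qed

text \<open>For $n = 0$ there are no unit vectors, but the empty input is disjoint and still needs a
  positive anchor.\<close>

lemma hnn_representation_DISJ_0: "hnn_representation 0 (DISJ 0) {0\<^sub>v 0} {}"
  by (rule hnn_representationI) (auto simp: bool_cube_def DISJ_def disj_def scalar_prod_def)

theorem theorem10:
  shows "(\<lambda>n. (2 * n, DISJ n)) \<in> HNN \<and>
    (\<forall>n\<ge>1. \<exists>P N. hnn_representation (2 * n) (DISJ n) P N \<and> card P + card N = 3 * n)"
proof
  show *: "\<forall>n\<ge>1. \<exists>P N. hnn_representation (2 * n) (DISJ n) P N \<and> card P + card N = 3 * n"
    using hnn_representation_DISJ card_anchors by blast
  \<comment> \<open>In the dimension d = 2n the polynomial 1 + 2d equals 4n + 1, which exceeds 3n;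
    its constant term pays for the single anchor at n = 0.\<close>
  have "\<exists>P N. hnn_representation (2 * n) (DISJ n) P N \<and> card P + card N \<le> poly [:1, 2:] (2 * n)" for n
  proof (cases "n = 0")
    case True
    then show ?thesis
      using hnn_representation_DISJ_0 by (intro exI[of _ "{0\<^sub>v 0}"] exI[of _ "{}"]) simp
  next
    case False
    with * obtain P N where "hnn_representation (2 * n) (DISJ n) P N" "card P + card N = 3 * n"
      by (metis One_nat_def Suc_leI neq0_conv)
    then show ?thesis
      by (intro exI[of _ P] exI[of _ N]) simp
  qed
  then show "(\<lambda>n. (2 * n, DISJ n)) \<in> HNN"
    unfolding HNN_def by fastforce
qed

end
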